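(* Let $n\ge 0$ be an integer and $0\le a\le 1$. The coefficients $c_k^{(n)}(a)$ in the expansion (as polynomials in $u$) $$q_n(au)=\sum_{k=0}^{n}c_k^{(n)}(a)\,q_k(u)$$ are given by $c_n^{(n)}(a)=a^n$ and, for $0\le k\le n-1$, $$c_k^{(n)}(a)=a^k\,\frac{\binom{n}{k}}{\binom{2n}{2k}}\sum_{r=1}^{(n-k)\wedge(k+1)}\binom{n+1}{k+1-r}\binom{n-k-1}{r-1}(1-a)^r .$$ In particular $c_k^{(n)}(a)\ge 0$ for all $0\le k\le n$.
   Context: For integers $n\ge0$, the (normalized) Bessel polynomial $q_n$ of degree $n$ is $$q_n(u)=\sum_{k=0}^{n}\alpha_k^{(n)}u^k,\qquad \alpha_k^{(n)}=\frac{n!\,(2n-k)!\,2^k}{(2n)!\,(n-k)!\,k!}.$$ Since $q_k$ has degree exactly $k$, expansions in the $q_k$ are unique. $x\wedge y$ denotes $\min(x,y)$. The convention $0^0=1$ is used. *)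

theory Defs
  imports Complex_Main "HOL-Computational_Algebra.Polynomial"
begin

definition bessel_coeff :: "nat \<Rightarrow> nat \<Rightarrow> real" where
  "bessel_coeff n k =
     (fact n * fact (2 * n - k) * 2 ^ k) / (fact (2 * n) * fact (n - k) * fact k)"

definition bessel_poly :: "nat \<Rightarrow> real poly" where
  "bessel_poly n = (\<Sum>k\<le>n. monom (bessel_coeff n k) k)"

(* The identity q_n(a u) = sum_{k=0}^n c_k q_k(u), as polynomials in u;
   composing with [:0, a:] substitutes a * u for u. *)
definition is_bessel_expansion :: "nat \<Rightarrow> real \<Rightarrow> (nat \<Rightarrow> real) \<Rightarrow> bool" where
  "is_bessel_expansion n a c \<longleftrightarrow>
     pcompose (bessel_poly n) [:0, a:] = (\<Sum>k\<le>n. smult (c k) (bessel_poly k))"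

end

(* The Bessel polynomials satisfy q_{n+2} = q_{n+1} + u^2 q_n / ((2n+1)(2n+3)). Substituting a u
   and expressing u^2 q_k as a multiple of q_{k+2} - q_{k+1}, by the same recurrence, gives a
   recurrence in n for the connection coefficients. With m = n - k, the prefactor of c_k is
   (1/2)_k (1/2)_m / (1/2)_n, and after dividing it out, comparing powers of 1 - a reduces the
   recurrence to an identity between products of binomial coefficients. *)
theory Submission
  imports Defs
begin

section \<open>Coefficients, recurrence and linear independence of the Bessel polynomials\<close>

lemma coeff_bessel_poly:
  "coeff (bessel_poly n) k = (if k \<le> n then bessel_coeff n k else 0)"
  by (auto simp: bessel_poly_def coeff_sum)

lemma bessel_coeff_0 [simp]: "bessel_coeff n 0 = 1"
  by (simp add: bessel_coeff_def)

lemma bessel_coeff_1: "bessel_coeff (Suc n) (Suc 0) = 1"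
  by (simp add: bessel_coeff_def divide_simps)

text \<open>Here and in \<open>bessel_coeff_shift1\<close> the coefficients are rational multiples
  of the same \<open>bessel_coeff n j\<close>, which turns the recurrence into an identity of
  rational functions.\<close>

lemma bessel_coeff_shift2:
  assumes "j \<le> n"
  shows "bessel_coeff (n + 2) (j + 2) = bessel_coeff n j *
    ((2 * real n + 2 - real j) * (2 * real n + 1 - real j) /
     ((2 * real n + 1) * (2 * real n + 3) * ((real j + 1) * (real j + 2))))"
proof -
  obtain d where n: "n = j + d"
    using assms le_Suc_ex by blast
  have eq: "bessel_coeff (n + 2) (j + 2) =
      (fact (Suc (Suc n)) * fact (Suc (Suc (2 * n - j))) * (4 * 2 ^ j)) /
      (fact (Suc (Suc (Suc (Suc (2 * n))))) * fact (n - j) * fact (Suc (Suc j)))"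
    unfolding bessel_coeff_def n by (simp del: fact_Suc)
  have f1: "fact (Suc (Suc (2 * n - j))) =
      (2 * real n + 2 - real j) * (2 * real n + 1 - real j) * fact (2 * n - j)"
    by (simp add: n algebra_simps)
  have f2: "fact (Suc (Suc (Suc (Suc (2 * n))))) =
      4 * ((real n + 2) * (real n + 1)) * ((2 * real n + 1) * (2 * real n + 3)) * fact (2 * n)"
    by (simp add: algebra_simps)
  have f3: "fact (Suc (Suc n)) = (real n + 2) * (real n + 1) * fact n" for n
    by (simp add: algebra_simps)
  have alg: "(K * x * (A * y) * (4 * z)) / (4 * K * L * u * v * (M' * M * w)) =
      x * y * z / (u * v * w) * (A / (L * (M * M')))" if "K \<noteq> 0"
    for A K L M M' u v w x y z :: real
    using that by (simp add: mult_ac)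
  show ?thesis
    unfolding eq f1 f2 f3[of n] f3[of j] bessel_coeff_def[of n j]
    by (rule alg) auto
qed

text \<open>The bound on \<open>j\<close> is strict because truncated subtraction makes
  \<open>bessel_coeff (n + 1) (n + 2)\<close> nonzero, although \<open>bessel_poly (n + 1)\<close>
  has no such term.\<close>

lemma bessel_coeff_shift1:
  assumes "j < n"
  shows "bessel_coeff (n + 1) (j + 2) = bessel_coeff n j *
    (2 * (real n - real j) / ((2 * real n + 1) * ((real j + 1) * (real j + 2))))"
proof -
  obtain d where n: "n = Suc (j + d)"
    using assms less_iff_Suc_add by auto
  have eq: "bessel_coeff (n + 1) (j + 2) =
      (fact (Suc n) * fact (2 * n - j) * (4 * 2 ^ j)) /
      (fact (Suc (Suc (2 * n))) * fact d * fact (Suc (Suc j)))"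
    unfolding bessel_coeff_def n by (simp del: fact_Suc)
  have eq': "bessel_coeff n j = (fact n * fact (2 * n - j) * 2 ^ j) /
      (fact (2 * n) * fact (Suc d) * fact j)"
    unfolding bessel_coeff_def n by (simp del: fact_Suc)
  have f1: "fact (Suc (Suc (2 * n))) = 2 * (real n + 1) * (2 * real n + 1) * fact (2 * n)"
    by (simp add: algebra_simps)
  have f2: "fact (Suc (Suc j)) = (real j + 2) * (real j + 1) * fact j"
    by (simp add: algebra_simps)
  have f3: "fact (Suc d) = (real n - real j) * fact d"
    by (simp add: n)
  have f4: "fact (Suc n) = (real n + 1) * fact n"
    by simp
  have alg: "(K * x * y * (4 * z)) / (2 * K * L * u * v * (M' * M * w)) =
      x * y * z / (u * (D * v) * w) * (2 * D / (L * (M * M')))" if "K \<noteq> 0" "D \<noteq> 0"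
    for D K L M M' u v w x y z :: real
    using that by (simp add: mult_ac)
  show ?thesis
    unfolding eq eq' f1 f2 f3 f4
    by (rule alg) (use assms in auto)
qed

lemma bessel_coeff_rec:
  assumes "j < n"
  shows "bessel_coeff (n + 2) (j + 2) =
    bessel_coeff (n + 1) (j + 2) + bessel_coeff n j / ((2 * real n + 1) * (2 * real n + 3))"
proof -
  define D where "D = (real j + 1) * (real j + 2)"
  have "D \<noteq> 0" "2 * real n + 1 \<noteq> 0" "2 * real n + 3 \<noteq> 0"
    unfolding D_def by auto
  \<comment> \<open>Over the common denominator, the first summand loses
    \<open>2 * real n + 3\<close> and becomes the ratio of \<open>bessel_coeff_shift1\<close>; the
    second loses \<open>D\<close>.\<close>
  moreover have "(2 * real n + 2 - real j) * (2 * real n + 1 - real j) =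
      2 * (real n - real j) * (2 * real n + 3) + D"
    by (simp add: D_def algebra_simps)
  ultimately have "(2 * real n + 2 - real j) * (2 * real n + 1 - real j) /
      ((2 * real n + 1) * (2 * real n + 3) * D) =
      2 * (real n - real j) / ((2 * real n + 1) * D) + 1 / ((2 * real n + 1) * (2 * real n + 3))"
    by (simp add: divide_simps)
  then show ?thesis
    unfolding bessel_coeff_shift1[OF assms] bessel_coeff_shift2[OF less_imp_le[OF assms]]
      D_def[symmetric]
    by (simp add: distrib_left)
qed

text \<open>The leading coefficient is separate: q_{n+1} does not reach u^(n+2).\<close>

lemma bessel_coeff_rec_top:
  "bessel_coeff (n + 2) (n + 2) = bessel_coeff n n / ((2 * real n + 1) * (2 * real n + 3))"
proof -
  have "(2 * real n + 2 - real n) * (2 * real n + 1 - real n) = (real n + 1) * (real n + 2)"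
    by (simp add: algebra_simps)
  moreover have "(real n + 1) * (real n + 2) \<noteq> 0"
    by auto
  ultimately show ?thesis
    unfolding bessel_coeff_shift2[OF order_refl] by simp
qed

lemma bessel_poly_rec:
  "bessel_poly (n + 2) = bessel_poly (n + 1) +
     smult (1 / ((2 * real n + 1) * (2 * real n + 3))) (monom 1 2 * bessel_poly n)"
proof (rule poly_eqI)
  fix k :: nat
  \<comment> \<open>u^2 q_n does not touch the powers 0 and 1, where q_{n+1} and q_{n+2} both have
    coefficient 1.\<close>
  consider "k = 0" | "k = 1" | j where "k = j + 2"
    by (metis One_nat_def add_2_eq_Suc' not0_implies_Suc)
  then show "coeff (bessel_poly (n + 2)) k = coeff (bessel_poly (n + 1) +
     smult (1 / ((2 * real n + 1) * (2 * real n + 3))) (monom 1 2 * bessel_poly n)) k"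
  proof cases
    case 3
    then show ?thesis
      using bessel_coeff_rec[of j n] bessel_coeff_rec_top[of n]
      by (cases j n rule: linorder_cases) (auto simp: coeff_bessel_poly coeff_monom_mult)
  qed (simp_all add: coeff_bessel_poly coeff_monom_mult bessel_coeff_1)
qed

text \<open>Only the last summand reaches the top power, and its leading coefficient is nonzero, so
  the scalars vanish from the top down.\<close>

lemma bessel_poly_lincomb_eq_0:
  assumes "(\<Sum>k\<le>n. smult (d k) (bessel_poly k)) = 0" and "k \<le> n"
  shows "d k = 0"
  using assms
proof (induction n)
  case 0
  then show ?case by (simp add: bessel_poly_def monom_0)
next
  case (Suc n)
  have "0 = coeff (\<Sum>k\<le>Suc n. smult (d k) (bessel_poly k)) (Suc n)"
    using Suc.prems by simp
  also have "\<dots> = d (Suc n) * bessel_coeff (Suc n) (Suc n)"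
    by (simp add: coeff_sum coeff_bessel_poly)
  finally have "d (Suc n) = 0"
    by (auto simp: bessel_coeff_def)
  then show ?case
    using Suc by (cases "k = Suc n") auto
qed

section \<open>The binomial sum and its recurrence\<close>

text \<open>The sum over \<open>r\<close> in \<open>c\<^sub>k\<close>, with \<open>m = n - k\<close>, \<open>r = s + 1\<close> and the first binomial
  coefficient in its complementary form, so that the terms with \<open>r > k + 1\<close> vanish instead of
  being spoilt by truncated subtraction.\<close>
definition conn_poly :: "real \<Rightarrow> nat \<Rightarrow> nat \<Rightarrow> real" where
  "conn_poly b n m = (case m of 0 \<Rightarrow> 1
     | Suc p \<Rightarrow> (\<Sum>s\<le>p. real ((n + 1) choose (p + s + 2)) * real (p choose s) * b ^ (s + 1)))"

lemma conn_poly_0 [simp]: "conn_poly b n 0 = 1"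
  by (simp add: conn_poly_def)

lemma conn_poly_1: "conn_poly b n (Suc 0) = real n * (real n + 1) / 2 * b"
  by (simp add: conn_poly_def gbinomial_prod_rev binomial_gbinomial flip: numeral_2_eq_2)
     (simp add: numeral_2_eq_2 algebra_simps)

text \<open>Every lower index \<open>p + s + 2\<close> exceeds \<open>n + 1\<close>. This settles
  the recurrence at the indices 0 and 1.\<close>

lemma conn_poly_eq_0: "n < m \<Longrightarrow> conn_poly b n m = 0"
  by (cases m) (auto simp: conn_poly_def binomial_eq_0 simp del: binomial_Suc_Suc intro!: sum.neutral)

text \<open>Real subtraction keeps this valid for \<open>t > n\<close>, where both binomials
  vanish.\<close>

lemma binomial_absorb_real:
  "(real t + 1) * real (n choose Suc t) = (real n - real t) * real (n choose t)"
proof (cases "t \<le> n")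
  case True
  have "Suc t * (n choose Suc t) = (n - t) * (n choose t)"
    by (metis binomial_absorb_comp binomial_absorption)
  then have "real (Suc t * (n choose Suc t)) = real ((n - t) * (n choose t))"
    by (rule arg_cong)
  with True show ?thesis by (simp add: of_nat_diff algebra_simps)
qed (simp add: not_le binomial_eq_0)

text \<open>With \<open>t = m + s\<close>, the variables stand for \<open>X = (n choose t)\<close>, \<open>Y = (n choose t + 1)\<close>,
  \<open>U = (m - 1 choose s)\<close> and \<open>V = (m - 1 choose s - 1)\<close>.\<close>
lemma conn_term_identity:
  fixes X Y U V m n s :: real
  assumes XY: "(m + s + 1) * Y = (n - (m + s)) * X" and UV: "s * U = (m - s) * V"
  shows "(2 * m + 1) * (2 * Y + X) * (U + V) =
    (2 * n + 1) * (X + Y) * U - (2 * (n - m) + 1) * (Y * U - X * V)"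
  using assms by algebra

text \<open>With \<open>1 - b\<close> as a, this is the recurrence for the coefficient of q_k,
  stripped of prefactors: the terms belong to index k in rows n+2 and n+1, and to k-2 and k-1 in row
  n.\<close>

lemma conn_poly_rec:
  assumes "Suc n = m + k"
  shows "(2 * real m + 1) * conn_poly b (n + 2) (m + 1) =
    (2 * real n + 3) * conn_poly b (n + 1) m + (2 * real m + 1) * conn_poly b n (m + 1) -
    (2 * real k + 1) * (1 - b) * conn_poly b n m"
proof (cases m)
  case 0
  then have k: "real k = real n + 1"
    using assms by simp
  show ?thesis
    unfolding 0 k by (simp add: conn_poly_1 field_simps)
next
  case (Suc p)
  \<comment> \<open>Pascal's rule reduces all binomials to three neighbours in row n+1 and two in
    row p. \<open>V\<close> is \<open>U\<close> shifted by one, with value 0 at the start, so that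
    all sums share the range \<open>s \<le> Suc p\<close>.\<close>
  define V where "V s = (case s of 0 \<Rightarrow> 0 | Suc r \<Rightarrow> real (p choose r))" for s
  define U where "U s = real (p choose s)" for s
  define X where "X s = real (Suc n choose (p + s + 1))" for s
  define Y where "Y s = real (Suc n choose (p + s + 2))" for s
  define Z where "Z s = real (Suc n choose (p + s + 3))" for s
  have UV: "real (Suc p choose s) = U s + V s" for s
    by (cases s) (simp_all add: U_def V_def)
  have U0: "U (Suc p) = 0"
    by (simp add: U_def)
  have P1: "conn_poly b (n + 2) (m + 1) =
      (\<Sum>s\<le>Suc p. (X s + 2 * Y s + Z s) * (U s + V s) * b ^ (s + 1))"
    unfolding Suc conn_poly_def UV[symmetric]
    by (auto simp: X_def Y_def Z_def eval_nat_numeral simp del: sum.atMost_Suc intro!: sum.cong)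
  have P2: "conn_poly b (n + 1) m = (\<Sum>s\<le>Suc p. (X s + Y s) * U s * b ^ (s + 1))"
    unfolding Suc conn_poly_def sum.atMost_Suc U0
    by (auto simp: X_def Y_def U_def eval_nat_numeral intro!: sum.cong)
  have P3: "conn_poly b n (m + 1) = (\<Sum>s\<le>Suc p. Z s * (U s + V s) * b ^ (s + 1))"
    unfolding Suc conn_poly_def UV[symmetric]
    by (auto simp: Z_def eval_nat_numeral simp del: sum.atMost_Suc binomial_Suc_Suc intro!: sum.cong)
  have P4: "conn_poly b n m = (\<Sum>s\<le>Suc p. Y s * U s * b ^ (s + 1))"
    unfolding Suc conn_poly_def sum.atMost_Suc U0
    by (auto simp: Y_def U_def intro!: sum.cong)
  \<comment> \<open>The factor b raises s by one, and \<open>X (Suc s) = Y s\<close>,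
    \<open>V (Suc s) = U s\<close>.\<close>
  have "b * conn_poly b n m = (\<Sum>s\<le>Suc p. X s * V s * b ^ (s + 1))"
    unfolding Suc conn_poly_def sum.atMost_Suc_shift
    by (auto simp: X_def V_def sum_distrib_left simp del: binomial_Suc_Suc intro!: sum.cong)
  with P4 have P5: "(1 - b) * conn_poly b n m = (\<Sum>s\<le>Suc p. (Y s * U s - X s * V s) * b ^ (s + 1))"
    by (simp only: left_diff_distrib sum_subtractf mult_1)
  \<comment> \<open>The \<open>Z\<close> terms cancel; the rest is \<open>conn_term_identity\<close>
    with n+1 for n.\<close>
  have "(2 * real m + 1) * ((X s + 2 * Y s + Z s) * (U s + V s) * b ^ (s + 1)) =
      (2 * real n + 3) * ((X s + Y s) * U s * b ^ (s + 1)) +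
      (2 * real m + 1) * (Z s * (U s + V s) * b ^ (s + 1)) -
      (2 * real k + 1) * ((Y s * U s - X s * V s) * b ^ (s + 1))" for s
  proof -
    have XY: "(real m + real s + 1) * Y s = (real n + 1 - (real m + real s)) * X s"
      using binomial_absorb_real[of "p + s + 1" "Suc n"]
      by (simp add: X_def Y_def Suc algebra_simps del: binomial_Suc_Suc)
    have sUV: "real s * U s = (real m - real s) * V s"
    proof (cases s)
      case (Suc r)
      then show ?thesis
        using binomial_absorb_real[of r p] \<open>m = Suc p\<close>
        by (simp add: U_def V_def algebra_simps)
    qed (simp add: V_def)
    have k: "real k = real n + 1 - real m"
      using assms by linarith
    show ?thesis
      using arg_cong[OF conn_term_identity[OF XY sUV], of "\<lambda>t. t * b ^ (s + 1)"]
      unfolding k by (simp only: algebra_simps)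
  qed
  then show ?thesis
    unfolding mult.assoc[of _ "1 - b"] P5 P1 P2 P3 sum_distrib_left
    by (simp only: sum.distrib[symmetric] sum_subtractf[symmetric])
qed

section \<open>Recurrence for the connection coefficients\<close>

text \<open>The Pochhammer quotient equals (n choose k) / (2n choose 2k), but an index shift only
  multiplies it by linear factors. The value 0 beyond n allows sums to be padded.\<close>

definition conn_coeff :: "nat \<Rightarrow> real \<Rightarrow> nat \<Rightarrow> real" where
  "conn_coeff n a k = (if k \<le> n then a ^ k *
     (pochhammer (1/2) k * pochhammer (1/2) (n - k) / pochhammer (1/2) n) *
     conn_poly (1 - a) n (n - k) else 0)"

lemma pochhammer_half_nonzero [simp]: "pochhammer (1/2 :: real) n \<noteq> 0"
  by (metis half_gt_zero pochhammer_pos less_irrefl zero_less_one)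

text \<open>u^2 q_k expands in q_{k+2} and q_{k+1} only, so q_0 receives nothing from it.\<close>

lemma conn_coeff_rec_0: "conn_coeff (n + 2) a 0 = conn_coeff (n + 1) a 0"
proof -
  have "(2 * real n + 3) * conn_poly (1 - a) (n + 2) (n + 2) =
      (2 * real n + 3) * conn_poly (1 - a) (n + 1) (n + 1)"
    using conn_poly_rec[of n "n + 1" 0 "1 - a"]
    by (simp add: conn_poly_eq_0 add.commute)
  moreover have "2 * real n + 3 \<noteq> 0"
    by simp
  ultimately have "conn_poly (1 - a) (n + 2) (n + 2) = conn_poly (1 - a) (n + 1) (n + 1)"
    using mult_left_cancel by blast
  then show ?thesis
    by (simp add: conn_coeff_def)
qed

text \<open>q_1 is reached only from u^2 q_0 = 3 (q_2 - q_1).\<close>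

lemma conn_coeff_rec_1:
  "conn_coeff (n + 2) a 1 = conn_coeff (n + 1) a 1 -
    a\<^sup>2 / ((2 * real n + 1) * (2 * real n + 3)) * (3 * conn_coeff n a 0)"
proof -
  define h where "h = pochhammer (1/2 :: real)"
  define P where "P = conn_poly (1 - a)"
  have h1: "h (n + 1) = h n * (2 * real n + 1) / 2" for n
    by (simp add: h_def pochhammer_Suc field_simps)
  have h2: "h (n + 2) = h n * ((2 * real n + 1) * (2 * real n + 3)) / 4" for n
    using h1[of n] h1[of "n + 1"] by (simp add: field_simps)
  have rec: "P (n + 2) (n + 1) = ((2 * real n + 3) * P (n + 1) n - 3 * a * P n n) / (2 * real n + 1)"
    using conn_poly_rec[of n n 1 "1 - a"]
    by (simp add: P_def conn_poly_eq_0 field_simps)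
  have e1: "conn_coeff (n + 2) a 1 = a * (1 / 2 * h (n + 1) / h (n + 2)) * P (n + 2) (n + 1)"
    by (simp add: conn_coeff_def h_def P_def)
  have e2: "conn_coeff (n + 1) a 1 = a * (1 / 2 * h n / h (n + 1)) * P (n + 1) n"
    by (simp add: conn_coeff_def h_def P_def)
  have e3: "conn_coeff n a 0 = P n n"
    by (simp add: conn_coeff_def P_def)
  have alg: "a * (1 / 2 * (hn * M / 2) / (hn * (M * D) / 4)) * ((D * p - 3 * a * q) / M) =
      a * (1 / 2 * hn / (hn * M / 2)) * p - a\<^sup>2 / (M * D) * (3 * q)"
    if "hn \<noteq> 0" "M \<noteq> 0" "D \<noteq> 0" for hn M D p q :: real
    using that by (simp add: divide_simps) (simp add: power2_eq_square algebra_simps)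
  show ?thesis
    unfolding e1 e2 e3 rec h1 h2 by (rule alg) (auto simp: h_def)
qed

text \<open>q_{k+2} occurs in u^2 q_k with positive sign and in u^2 q_{k+1} with negative
  sign.\<close>

lemma conn_coeff_rec:
  assumes "k \<le> n"
  shows "conn_coeff (n + 2) a (k + 2) = conn_coeff (n + 1) a (k + 2) +
    a\<^sup>2 / ((2 * real n + 1) * (2 * real n + 3)) *
     ((2 * real k + 1) * (2 * real k + 3) * conn_coeff n a k -
      (2 * real k + 3) * (2 * real k + 5) * conn_coeff n a (k + 1))"
\<comment> \<open>For k = n only leading coefficients remain; \<open>conn_poly_rec\<close> would
  need m = -1.\<close>
proof (cases "k = n")
  case True
  then show ?thesis
    by (simp add: conn_coeff_def divide_simps) (simp add: power2_eq_square algebra_simps)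
next
  case False
  with assms obtain m where n: "n = Suc (k + m)"
    using less_iff_Suc_add by (metis le_neq_implies_less)
  define h where "h = pochhammer (1/2 :: real)"
  define P where "P = conn_poly (1 - a)"
  have rec: "P (n + 2) (m + 1) = ((2 * real n + 3) * P (n + 1) m + (2 * real m + 1) * P n (m + 1) -
      (2 * real k + 5) * a * P n m) / (2 * real m + 1)"
    using conn_poly_rec[of n m "k + 2" "1 - a"]
    by (simp add: n P_def field_simps)
  have nz: "h j \<noteq> 0" "2 * real j + 1 \<noteq> 0" "2 * real j + 3 \<noteq> 0" for j
    by (auto simp: h_def)
  have h1: "h (Suc j) = h j * (2 * real j + 1) / 2" for j
    by (simp add: h_def pochhammer_Suc field_simps)
  have h2: "h (j + 2) = h j * ((2 * real j + 1) * (2 * real j + 3)) / 4" for j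
    using h1[of j] h1[of "Suc j"] by (simp add: field_simps)
  have h1': "h (j + 1) = h j * (2 * real j + 1) / 2" for j
    using h1 by simp
  have e1: "conn_coeff (n + 2) a (k + 2) = a ^ (k + 2) * (h (k + 2) * h (m + 1) / h (n + 2)) * P (n + 2) (m + 1)"
    by (simp add: conn_coeff_def n h_def P_def)
  have e2: "conn_coeff (n + 1) a (k + 2) = a ^ (k + 2) * (h (k + 2) * h m / h (n + 1)) * P (n + 1) m"
    by (simp add: conn_coeff_def n h_def P_def)
  have e3: "conn_coeff n a k = a ^ k * (h k * h (m + 1) / h n) * P n (m + 1)"
    by (simp add: conn_coeff_def n h_def P_def)
  have e4: "conn_coeff n a (k + 1) = a ^ k * a * (h (k + 1) * h m / h n) * P n m"
    by (simp add: conn_coeff_def n h_def P_def)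
  \<comment> \<open>The identity for free variables: \<open>c'\<close> is a^k, \<open>A\<close>,
    \<open>B\<close>, \<open>E\<close> are 2k+1, 2k+3, 2k+5, \<open>C\<close>, \<open>D\<close> are
    2n+1, 2n+3, and \<open>M\<close> is 2m+1.\<close>
  have alg: "c * ((hk * (A * B) / 4) * (hm * M / 2) / (hn * (C * D) / 4)) * ((D * p + M * q - E * a * r) / M) =
      c * ((hk * (A * B) / 4) * hm / (hn * C / 2)) * p +
      a\<^sup>2 / (C * D) * (A * B * (c' * (hk * (hm * M / 2) / hn) * q) - B * E * (c' * a * ((hk * A / 2) * hm / hn) * r))"
    if "c = c' * a\<^sup>2" "M \<noteq> 0" "C \<noteq> 0" "D \<noteq> 0" "hn \<noteq> 0"
    for c c' hk hm hn A B C D E M p q r :: real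
    using that(2-) unfolding that(1)
    by (simp add: divide_simps) (simp add: power2_eq_square algebra_simps)
  show ?thesis
    unfolding e1 e2 e3 e4 rec h2 h1'
    by (rule alg) (use nz in \<open>simp_all add: power_add power2_eq_square\<close>)
qed

section \<open>The expansion of q_n(au)\<close>

lemma monom_2_mult_bessel_poly:
  "monom 1 2 * bessel_poly n =
    smult ((2 * real n + 1) * (2 * real n + 3)) (bessel_poly (n + 2) - bessel_poly (n + 1))"
proof -
  have "(2 * real n + 1) * (2 * real n + 3) \<noteq> 0"
    by auto
  then show ?thesis
    unfolding bessel_poly_rec by simp
qed

lemma smult_sum_right: "smult a (\<Sum>i\<in>A. f i) = (\<Sum>i\<in>A. smult a (f i))"
  by (induction A rule: infinite_finite_induct) (simp_all add: smult_add_right)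

lemma bessel_poly_expansion:
  "pcompose (bessel_poly n) [:0, a:] = (\<Sum>k\<le>n. smult (conn_coeff n a k) (bessel_poly k))"
proof (induction n rule: less_induct)
  case (less n)
  consider "n = 0" | "n = 1" | n' where "n = n' + 2"
    by (metis One_nat_def add_2_eq_Suc' not0_implies_Suc)
  then show ?case
  proof cases
    case 1
    then show ?thesis
      by (simp add: bessel_poly_def conn_coeff_def monom_0)
  next
    case 2
    then show ?thesis
      by (simp add: bessel_poly_def conn_coeff_def monom_0 conn_poly_1 bessel_coeff_1 pochhammer_Suc
        monom_Suc pcompose_pCons pcompose_add)
  next
    case (3 n')
    define \<kappa> where "\<kappa> = a\<^sup>2 / ((2 * real n' + 1) * (2 * real n' + 3))"
    define f where "f k = (2 * real k + 1) * (2 * real k + 3) * conn_coeff n' a k" for k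
    have f0: "f (Suc n') = 0"
      by (simp add: f_def conn_coeff_def)
    have "pcompose (bessel_poly n) [:0, a:] = pcompose (bessel_poly (n' + 1)) [:0, a:] +
        smult \<kappa> (monom 1 2 * pcompose (bessel_poly n') [:0, a:])"
      unfolding 3 bessel_poly_rec
      by (simp add: pcompose_add pcompose_smult pcompose_mult \<kappa>_def monom_altdef pcompose_pCons
        numeral_2_eq_2)
    also have "monom 1 2 * pcompose (bessel_poly n') [:0, a:] =
        (\<Sum>k\<le>n'. smult (f k) (bessel_poly (k + 2) - bessel_poly (k + 1)))"
      using less.IH[of n'] 3
      by (simp add: sum_distrib_left mult_smult_right monom_2_mult_bessel_poly f_def
        mult.commute[of "conn_coeff n' a _"])
    \<comment> \<open>The sum is padded by a zero term at n'+2 to match the target range.\<close>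
    also have "pcompose (bessel_poly (n' + 1)) [:0, a:] =
        (\<Sum>k\<le>n'+2. smult (conn_coeff (n' + 1) a k) (bessel_poly k))"
      using less.IH[of "n' + 1"] 3 by (simp add: conn_coeff_def)
    also have "\<dots> = smult (conn_coeff (n' + 1) a 0) (bessel_poly 0) +
        smult (conn_coeff (n' + 1) a 1) (bessel_poly 1) +
        (\<Sum>k\<le>n'. smult (conn_coeff (n' + 1) a (k + 2)) (bessel_poly (k + 2)))"
      by (simp only: add_2_eq_Suc' sum.atMost_Suc_shift) simp
    \<comment> \<open>Summation by parts: \<open>f0\<close> extends the second sum by one term, and
      splitting off its first leaves \<open>f 0\<close> at q_1.\<close>
    also have "(\<Sum>k\<le>n'. smult (f k) (bessel_poly (k + 2) - bessel_poly (k + 1))) =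
        (\<Sum>k\<le>n'. smult (f k) (bessel_poly (k + 2))) - (\<Sum>k\<le>Suc n'. smult (f k) (bessel_poly (k + 1)))"
      by (simp add: smult_diff_right sum_subtractf f0)
    also have "\<dots> = (\<Sum>k\<le>n'. smult (f k - f (k + 1)) (bessel_poly (k + 2))) -
        smult (f 0) (bessel_poly 1)"
      unfolding sum.atMost_Suc_shift by (simp add: smult_diff_left sum_subtractf)
    finally have "pcompose (bessel_poly n) [:0, a:] =
        smult (conn_coeff (n' + 1) a 0) (bessel_poly 0) +
        smult (conn_coeff (n' + 1) a 1 - \<kappa> * f 0) (bessel_poly 1) +
        (\<Sum>k\<le>n'. smult (conn_coeff (n' + 1) a (k + 2) + \<kappa> * (f k - f (k + 1))) (bessel_poly (k + 2)))"
      by (simp add: smult_add_left smult_diff_left smult_diff_right smult_sum_right right_diff_distrib sum.distrib)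
    also have "\<dots> = smult (conn_coeff n a 0) (bessel_poly 0) +
        smult (conn_coeff n a 1) (bessel_poly 1) +
        (\<Sum>k\<le>n'. smult (conn_coeff n a (k + 2)) (bessel_poly (k + 2)))"
      unfolding 3 conn_coeff_rec_0 conn_coeff_rec_1
      by (intro arg_cong2[of _ _ _ _ "(+)"] sum.cong refl)
         (simp_all add: conn_coeff_rec \<kappa>_def f_def algebra_simps del: add_2_eq_Suc')
    also have "\<dots> = (\<Sum>k\<le>n. smult (conn_coeff n a k) (bessel_poly k))"
      unfolding 3 by (simp only: add_2_eq_Suc' sum.atMost_Suc_shift) simp
    finally show ?thesis .
  qed
qed

section \<open>The closed form, uniqueness and nonnegativity\<close>

text \<open>By (2n)! = 4^n (1/2)_n n!, the powers of 4 and the factorials cancel.\<close>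

lemma binomial_quotient_eq_pochhammer:
  assumes "k \<le> n"
  shows "real (n choose k) / real ((2 * n) choose (2 * k)) =
    pochhammer (1/2) k * pochhammer (1/2) (n - k) / pochhammer (1/2) n"
proof -
  have "2 * n - 2 * k = 2 * (n - k)"
    by simp
  moreover have "(2 :: real) ^ (2 * n) = 2 ^ (2 * k) * 2 ^ (2 * (n - k))"
    using assms by (simp flip: power_add)
  ultimately show ?thesis
    using assms by (simp add: binomial_fact fact_double divide_simps)
qed

lemma conn_poly_eq_sum:
  assumes "k < n"
  shows "conn_poly b n (n - k) = (\<Sum>r = 1..min (n - k) (k + 1).
    real ((n + 1) choose (k + 1 - r)) * real ((n - k - 1) choose (r - 1)) * b ^ r)"
proof -
  obtain p where n: "n = Suc (k + p)"
    using assms less_iff_Suc_add by auto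
  have "conn_poly b n (n - k) =
      (\<Sum>s\<le>p. real ((n + 1) choose (p + s + 2)) * real (p choose s) * b ^ (s + 1))"
    by (simp add: conn_poly_def n)
  also have "\<dots> = (\<Sum>s\<le>min p k. real ((n + 1) choose (p + s + 2)) * real (p choose s) * b ^ (s + 1))"
    by (rule sum.mono_neutral_right) (auto simp: n binomial_eq_0 simp del: binomial_Suc_Suc)
  \<comment> \<open>The lower indices add up to n+1 since s \<le> k, so the subtraction is not
    truncated.\<close>
  also have "\<dots> = (\<Sum>s\<le>min p k. real ((n + 1) choose (k - s)) * real (p choose s) * b ^ (s + 1))"
  proof (intro sum.cong refl)
    fix s assume "s \<in> {..min p k}"
    then have "(n + 1) choose (p + s + 2) = (n + 1) choose (k - s)"
      using binomial_symmetric[of "k - s" "n + 1"] by (simp add: n del: binomial_Suc_Suc)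
    then show "real ((n + 1) choose (p + s + 2)) * real (p choose s) * b ^ (s + 1) =
      real ((n + 1) choose (k - s)) * real (p choose s) * b ^ (s + 1)"
      by (simp only:)
  qed
  also have "\<dots> = (\<Sum>r = 1..Suc (min p k).
      real ((n + 1) choose (k + 1 - r)) * real ((n - k - 1) choose (r - 1)) * b ^ r)"
    by (simp only: One_nat_def sum.shift_bounds_cl_Suc_ivl atLeast0AtMost[symmetric]) (simp add: n)
  also have "Suc (min p k) = min (n - k) (k + 1)"
    by (simp add: n)
  finally show ?thesis .
qed

theorem theorem2p1:
  fixes n :: nat and a :: real
  assumes "0 \<le> a" and "a \<le> 1"
  shows "(\<exists>c. is_bessel_expansion n a c) \<and>
    (\<forall>c. is_bessel_expansion n a c \<longrightarrow>
       c n = a ^ n \<and>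
       (\<forall>k<n. c k = a ^ k * (real (n choose k) / real ((2 * n) choose (2 * k))) *
          (\<Sum>r = 1..min (n - k) (k + 1).
             real ((n + 1) choose (k + 1 - r)) * real ((n - k - 1) choose (r - 1)) * (1 - a) ^ r)) \<and>
       (\<forall>k\<le>n. 0 \<le> c k))"
proof (intro conjI allI impI)
  show "\<exists>c. is_bessel_expansion n a c"
    unfolding is_bessel_expansion_def using bessel_poly_expansion by blast
next
  fix c assume "is_bessel_expansion n a c"
  \<comment> \<open>The difference of two expansions is a vanishing combination, so \<open>c\<close>
    agrees with \<open>conn_coeff\<close> up to n.\<close>
  then have "(\<Sum>k\<le>n. smult (c k - conn_coeff n a k) (bessel_poly k)) = 0"
    by (simp add: is_bessel_expansion_def bessel_poly_expansion smult_diff_left sum_subtractf)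
  then have c: "c k = conn_coeff n a k" if "k \<le> n" for k
    using bessel_poly_lincomb_eq_0[of "\<lambda>k. c k - conn_coeff n a k"] that by fastforce
  show top: "c n = a ^ n"
    by (simp add: c conn_coeff_def)
  show formula: "c k = a ^ k * (real (n choose k) / real ((2 * n) choose (2 * k))) *
      (\<Sum>r = 1..min (n - k) (k + 1).
         real ((n + 1) choose (k + 1 - r)) * real ((n - k - 1) choose (r - 1)) * (1 - a) ^ r)"
    if "k < n" for k
    using that
    by (simp only: c less_imp_le conn_coeff_def if_True binomial_quotient_eq_pochhammer conn_poly_eq_sum)
  show "0 \<le> c k" if "k \<le> n" for k
  proof (cases "k = n")
    case False
    with that have "k < n" by simp
    show ?thesis
      unfolding formula[OF \<open>k < n\<close>] using assms
      by (intro mult_nonneg_nonneg sum_nonneg divide_nonneg_nonneg zero_le_power) simp_all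
  qed (use top assms in simp)
qed

end
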